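(* Let $n\ge 1$, let $N$ and $V$ be finite disjoint sets with $|N|=|V|=n$, and let $Q\subseteq\mathbb{R}^{n^3}$ be the polyhedron of achievable probabilities. For every $J\subseteq V$ with $|J|=h\in[n-1]$, every $t\in[n-h]$, and every $i_t,i_{t+1},\dots,i_{t+h-1}\in N$ (repetitions allowed), the inequality $$\sum_{\tau=t+h}^{n}Z_{N,J}^{\tau}+\sum_{\tau=t}^{t+h-1}n^{t+h-\tau}Z_{i_\tau,J}^{\tau}\le 1+\sum_{\tau=1}^{h-1}n^{\tau}$$ is facet-defining for $Q$.
   Context: $[n]=\{1,\dots,n\}$; singletons are identified with their element. For $I\subseteq N$, $J\subseteq V$, $t\in[n]$: $Z_{I,J}^t:=\sum_{i\in I}\sum_{j\in J}z_{ij}^t$. Online bipartite matching model: $N$ is the set of impression types, $V$ the set of ads, $|N|=|V|=n$, and there are $n$ stages, counted down $t=n,n-1,\dots,1$ (stage $n$ is first; $t$ is the number of remaining decision epochs including the current one). At each stage an impression type is drawn independently and uniformly from $N$ and must be immediately and irrevocably matched to a still-available ad of $V$ or discarded; each ad is matched at most once. All pairs in $N\times V$ may be matched. Polyhedron of achievable probabilities $Q$. Consider nonnegative variables $x_{i,j}^{t,S}$ for $t\in[n]$, $i\in N$, $j\in V$, $S\subseteq V\setminus j$ with $|S|\ge t-1$ (probability that in stage $t$ type $i$ appears, the available ads are $S\cup j$, and $i$ is matched to $j$), and $y_i^{t,S}$ for $t\in[n]$, $i\in N$, $S\subseteq V$ with $|S|\ge t$ (probability that in stage $t$ type $i$ appears,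 the available ads are $S$, and $i$ is discarded), subject to (a) $\sum_{j\in V}x_{i,j}^{n,V\setminus j}+y_i^{n,V}\le \frac1n$ for $i\in N$; (b) $\sum_{j\in S}x_{i,j}^{t,S\setminus j}+y_i^{t,S}1_{\{t\ne1\}}-\frac1n 1_{\{|S|>t\}}\sum_{k\in N}y_k^{t+1,S}-\frac1n\sum_{k\in N}\sum_{j\in V\setminus S}x_{k,j}^{t+1,S}\le 0$ for $t\in[n-1]$, $i\in N$, $\emptyset\ne S\subsetneq V$ with $|S|\ge t$; (c) $\sum_{j\in V}x_{i,j}^{t,V\setminus j}+y_i^{t,V}1_{\{t\ne1\}}-\frac1n\sum_{k\in N}y_k^{t+1,V}\le0$ for $t\in[n-1]$, $i\in N$. Here $1_{\mathcal A}$ is $1$ if condition $\mathcal A$ holds and $0$ otherwise. $Q$ is the set of $z=(z_{ij}^t)_{i\in N,j\in V,t\in[n]}\in\mathbb{R}^{n^3}$ for which there is a feasible $(x,y)\ge0$ with $z_{ij}^t=\sum_{S}x_{i,j}^{t,S}$ (sum over $S\subseteq V\setminus j$ with $|S|\ge t-1$). Thus $z_{ij}^t$ is the probability that impression type $i$ is matched to ad $j$ in stage $t$ under some feasible policy. $Q$ is full-dimensional in $\mathbb{R}^{n^3}$. An inequality is facet-defining for $Q$ if it is valid for $Q$ and the set of points of $Q$ satisfying it with equality has dimension $n^3-1$. *)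

theory Defs
  imports "HOL-Analysis.Analysis"
begin

text \<open>
  The types \<open>'i\<close> and \<open>'v\<close> are the impression types and the ads, so that
  \<open>N = UNIV :: 'i set\<close>, \<open>V = UNIV :: 'v set\<close> and \<open>n = CARD('i)\<close>; the definitions below
  are meant for \<open>CARD('v) = CARD('i)\<close>. To have the stages \<open>{1..n}\<close> as coordinates of a
  Euclidean space they are made into a type; \<open>Abs_stage\<close> is only applied to numbers
  in \<open>{1..n}\<close>.
\<close>

typedef 'i stage = "{1..CARD('i::finite)}"
  morphisms stage_no Abs_stage
  by (rule exI[of _ 1]) (simp add: Suc_le_eq)

instance stage :: (finite) finite
proof
  show "finite (UNIV :: 'a stage set)"
    by (metis finite_atLeastAtMost finite_imageI type_definition.Abs_image
        type_definition_stage)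
qed

lemma card_stage: "CARD('i::finite stage) = CARD('i)"
  by (simp add: type_definition.card[OF type_definition_stage])

type_synonym ('i, 'v) prob_vec = "real ^ ('i \<times> 'v \<times> 'i stage)"

lemma DIM_prob_vec:
  assumes "CARD('v::finite) = CARD('i::finite)"
  shows "DIM(('i, 'v) prob_vec) = CARD('i) ^ 3"
  by (simp add: card_stage assms power3_eq_cube)

text \<open>
  \<open>x t S i j\<close> and \<open>y t S i\<close> stand for $x_{i,j}^{t,S}$ and $y_i^{t,S}$. They are total functions,
  but only their values at the indices below are ever used.
\<close>

definition x_index :: "nat \<Rightarrow> 'v::finite set \<Rightarrow> 'v \<Rightarrow> bool"
  where "x_index t S j \<longleftrightarrow> j \<notin> S \<and> card S \<ge> t - 1"

definition y_index :: "nat \<Rightarrow> 'v::finite set \<Rightarrow> bool"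
  where "y_index t S \<longleftrightarrow> card S \<ge> t"

definition feasible ::
  "(nat \<Rightarrow> 'v::finite set \<Rightarrow> 'i::finite \<Rightarrow> 'v \<Rightarrow> real) \<Rightarrow> (nat \<Rightarrow> 'v set \<Rightarrow> 'i \<Rightarrow> real) \<Rightarrow> bool"
  where "feasible x y \<longleftrightarrow> (let n = CARD('i) in
    (\<forall>t\<in>{1..n}. \<forall>S i j. x_index t S j \<longrightarrow> x t S i j \<ge> 0) \<and>
    (\<forall>t\<in>{1..n}. \<forall>S i. y_index t S \<longrightarrow> y t S i \<ge> 0) \<and>
    (\<forall>i. (\<Sum>j\<in>UNIV. x n (UNIV - {j}) i j) + y n UNIV i \<le> 1 / real n) \<and>
    (\<forall>t\<in>{1..n-1}. \<forall>i. \<forall>S. S \<noteq> {} \<and> S \<subset> UNIV \<and> card S \<ge> t \<longrightarrow>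
       (\<Sum>j\<in>S. x t (S - {j}) i j) + y t S i * of_bool (t \<noteq> 1)
       - 1 / real n * of_bool (card S > t) * (\<Sum>k\<in>UNIV. y (t + 1) S k)
       - 1 / real n * (\<Sum>k\<in>UNIV. \<Sum>j\<in>UNIV - S. x (t + 1) S k j) \<le> 0) \<and>
    (\<forall>t\<in>{1..n-1}. \<forall>i.
       (\<Sum>j\<in>UNIV. x t (UNIV - {j}) i j) + y t UNIV i * of_bool (t \<noteq> 1)
       - 1 / real n * (\<Sum>k\<in>UNIV. y (t + 1) UNIV k) \<le> 0))"

definition achievable :: "('i::finite, 'v::finite) prob_vec set"
  where "achievable = {z. \<exists>x y. feasible x y \<and>
    (\<forall>i j. \<forall>t\<in>{1..CARD('i)}. z $ (i, j, Abs_stage t) = (\<Sum>S | x_index t S j. x t S i j))}"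

definition Z :: "'i::finite set \<Rightarrow> 'v::finite set \<Rightarrow> nat \<Rightarrow> ('i, 'v) prob_vec \<Rightarrow> real"
  where "Z I J t z = (\<Sum>i\<in>I. \<Sum>j\<in>J. z $ (i, j, Abs_stage t))"

text \<open>
  For the inequality \<open>f z \<le> b\<close>, with \<open>f\<close> linear, and a full-dimensional \<open>Q\<close>.
\<close>

definition facet_defining :: "'a::euclidean_space set \<Rightarrow> ('a \<Rightarrow> real) \<Rightarrow> real \<Rightarrow> bool"
  where "facet_defining Q f b \<longleftrightarrow>
    (\<forall>z\<in>Q. f z \<le> b) \<and> aff_dim {z \<in> Q. f z = b} = int DIM('a) - 1"

end

theory Submission
  imports Defs
begin

text \<open>
  Read the left-hand side as an expected reward. The optimal value of the resulting dynamic program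
  depends only on the stage and on the number \<open>m\<close> of ads of \<open>J\<close> left: with \<open>k\<close>
  stages \<open>\<tau> \<ge> t\<close> still to come, it is
  \<open>\<Sum>l<min k m. n ^ (h - 1 - l)\<close>. As a potential function it bounds the reward of every
  feasible point (weak duality), and a policy attains the bound if it takes only tight actions, those
  without loss of potential.

  If two actions are tight in the same reachable state, two policies that differ only in this choice give
  points of the face that agree in all earlier stages (larger \<open>\<tau>\<close>) and whose difference in the current
  stage is a multiple of a difference of unit vectors (or of a unit vector, if one action is to discard).
  By induction on the number of remaining stages, these differences together with one single unit vector
  of nonzero reward span the whole space, so the face has codimension one.
\<close>

section \<open>Two general summation identities\<close>

text \<open>Removing \<open>j\<close> is a bijection between the two kinds of pairs. It translates
  between the state before a match and the remaining set, by which \<open>x\<close> is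
  indexed.\<close>

lemma sum_sets_reindex:
  fixes H :: "'v::finite set \<Rightarrow> 'v \<Rightarrow> 'a::comm_monoid_add"
  shows "(\<Sum>S\<in>UNIV. \<Sum>j\<in>S. H S j) = (\<Sum>S\<in>UNIV. \<Sum>j\<in>-S. H (insert j S) j)"
proof -
  have "(\<Sum>S\<in>UNIV. \<Sum>j\<in>S. H S j) = (\<Sum>S\<in>UNIV. \<Sum>j | j \<in> UNIV \<and> j \<in> S. H S j)"
    by simp
  also have "\<dots> = (\<Sum>j\<in>UNIV. \<Sum>S | S \<in> UNIV \<and> j \<in> S. H S j)"
    by (rule sum.swap_restrict) auto
  also have "\<dots> = (\<Sum>j\<in>UNIV. \<Sum>S | S \<in> UNIV \<and> j \<notin> S. H (insert j S) j)"
    by (intro sum.cong refl sum.reindex_bij_witness[where i = "insert _" and j = "\<lambda>S. S - {_}"])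
      (auto simp: insert_absorb)
  also have "\<dots> = (\<Sum>S\<in>UNIV. \<Sum>j | j \<in> UNIV \<and> j \<notin> S. H (insert j S) j)"
    by (rule sum.swap_restrict) auto
  finally show ?thesis
    by (simp add: Compl_eq)
qed

lemma vec_eq_sum_axis: "(\<Sum>p\<in>UNIV. v $ p *\<^sub>R axis p 1) = (v :: real ^ 'a::finite)"
  by (simp add: vec_eq_iff axis_def if_distrib cong: if_cong)

text \<open>Deterministic policies suffice to produce enough points of the face; \<open>None\<close>
  means to discard.\<close>

type_synonym ('i, 'v) policy = "nat \<Rightarrow> 'v set \<Rightarrow> 'i \<Rightarrow> 'v option"

definition successor :: "'v set \<Rightarrow> 'v option \<Rightarrow> 'v set"
  where "successor S A = S - set_option A"

lemma successor_simps [simp]: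
  "successor S None = S" "successor S (Some j) = S - {j}"
  by (auto simp: successor_def)

text \<open>Here \<open>t\<close> is the parameter of the inequality and \<open>\<tau>\<close> the
  running stage. The stages from \<open>t\<close> to \<open>t + h - 1\<close> form the window, in
  which \<open>s \<tau>\<close> is the rewarded type.\<close>

locale matching_face =
  fixes n h t :: nat
    and J :: "'v::finite set"
    and s :: "nat \<Rightarrow> 'i::finite"
  assumes card_i: "CARD('i) = n" and card_v: "CARD('v) = n"
    and card_J: "card J = h" and h_range: "h \<in> {1..n-1}"
    and t_range: "t \<in> {1..n-h}"
begin

subsection \<open>The dynamic program and validity\<close>

definition coef :: "nat \<Rightarrow> 'i \<Rightarrow> 'v \<Rightarrow> real"
  where "coef \<tau> i j =
    (if j \<notin> J then 0 else if t + h \<le> \<tau> then 1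
     else if t \<le> \<tau> \<and> i = s \<tau> then real n ^ (t + h - \<tau>) else 0)"

text \<open>
  With \<open>k = \<tau> - t\<close>, this is the optimal expected value still to be collected
  after stage \<open>\<tau>\<close> when the ads \<open>S\<close> are left.
\<close>
definition val :: "nat \<Rightarrow> 'v set \<Rightarrow> real"
  where "val k S = (\<Sum>l<min k (card (S \<inter> J)). real n ^ (h - 1 - l))"

text \<open>With more than \<open>\<tau> - t\<close> ads of \<open>J\<close> left for the
  \<open>\<tau> - t\<close> stages from \<open>\<tau> - 1\<close> down to \<open>t\<close>, one ad
  is surplus. Using it now costs nothing, so discarding the rewarded type would lose value.\<close>

definition forced :: "nat \<Rightarrow> 'v set \<Rightarrow> 'i \<Rightarrow> bool"
  where "forced \<tau> S i \<longleftrightarrow> t \<le> \<tau> \<and> \<tau> < t + h \<and> i = s \<tau> \<and> \<tau> - t < card (S \<inter> J)"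

text \<open>The optimal value once the type is known exceeds \<open>val (\<tau> - t) S\<close> by
  this amount.\<close>

definition bonus :: "nat \<Rightarrow> 'v set \<Rightarrow> 'i \<Rightarrow> real"
  where "bonus \<tau> S i = (if forced \<tau> S i then real n ^ (t + h - \<tau>) else 0)"

definition gain :: "nat \<Rightarrow> 'i \<Rightarrow> 'v option \<Rightarrow> real"
  where "gain \<tau> i A = (case A of None \<Rightarrow> 0 | Some j \<Rightarrow> coef \<tau> i j)"

text \<open>Equality in the Bellman inequality: the action is optimal.\<close>

definition tight :: "nat \<Rightarrow> 'v set \<Rightarrow> 'i \<Rightarrow> 'v option \<Rightarrow> bool"
  where "tight \<tau> S i A \<longleftrightarrow> set_option A \<subseteq> S \<and>
    gain \<tau> i A + val (\<tau> - t) (successor S A) = val (\<tau> - t) S + bonus \<tau> S i"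

section \<open>The Bellman equation and inequality\<close>

lemma n_ge_2: "n \<ge> 2" and h_pos: "h \<ge> 1" and t_pos: "t \<ge> 1" and th_le: "t + h \<le> n"
  using h_range t_range by auto

lemma card_int_J_le: "card (S \<inter> J) \<le> h"
  using card_J by (metis card_mono finite inf_le2)

lemma val_remove_outside: "j \<notin> J \<Longrightarrow> val k (S - {j}) = val k S"
  by (simp add: val_def Diff_Int_distrib2)

text \<open>At most the last summand disappears: an ad beyond the first \<open>k\<close> is
  surplus.\<close>

lemma val_remove:
  assumes "j \<in> S" "j \<in> J"
  shows "val k S = val k (S - {j}) +
    (if card (S \<inter> J) \<le> k then real n ^ (h - card (S \<inter> J)) else 0)"
proof -
  have "(S - {j}) \<inter> J = S \<inter> J - {j}" by auto
  moreover obtain m where m: "card (S \<inter> J) = Suc m"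
    using assms by (metis IntI card_Suc_Diff1 finite)
  ultimately have m': "card ((S - {j}) \<inter> J) = m"
    using assms by simp
  show ?thesis
    by (cases "Suc m \<le> k") (simp_all add: val_def m m' min_def)
qed

text \<open>The Bellman equation. Only \<open>s \<tau>\<close> contributes to the average over the
  types, and its probability \<open>1 / n\<close> turns \<open>n ^ (t + h - \<tau>)\<close> into the
  new summand with index \<open>\<tau> - t\<close>. Below \<open>t\<close> truncated subtraction
  makes both values zero.\<close>

lemma val_Suc:
  assumes "\<tau> \<ge> 1"
  shows "val (Suc \<tau> - t) S = val (\<tau> - t) S + (\<Sum>i\<in>UNIV. bonus \<tau> S i) / real n"
proof (cases "t \<le> \<tau> \<and> \<tau> < t + h \<and> \<tau> - t < card (S \<inter> J)")
  case True
  have "(\<Sum>i\<in>UNIV. bonus \<tau> S i) = (\<Sum>i\<in>UNIV. if i = s \<tau> then real n ^ (t + h - \<tau>) else 0)"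
    using True by (intro sum.cong) (auto simp: bonus_def forced_def)
  also have "\<dots> = real n ^ Suc (h - 1 - (\<tau> - t))"
  proof -
    have "t + h - \<tau> = Suc (h - 1 - (\<tau> - t))" using True by auto
    then show ?thesis by simp
  qed
  finally show ?thesis
    using True n_ge_2 by (simp add: val_def Suc_diff_le)
next
  case False
  then have "bonus \<tau> S i = 0" for i
    by (auto simp: bonus_def forced_def)
  moreover have "min (Suc \<tau> - t) (card (S \<inter> J)) = min (\<tau> - t) (card (S \<inter> J))"
    using False card_int_J_le[of S] by auto
  ultimately show ?thesis
    by (simp add: val_def)
qed

lemma val_nonneg: "val k S \<ge> 0"
  by (auto simp: val_def intro: sum_nonneg)

lemma bonus_nonneg: "bonus \<tau> S i \<ge> 0"
  by (simp add: bonus_def)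

text \<open>Taking a non-surplus ad of \<open>J\<close> when \<open>m\<close> are left costs
  \<open>n ^ (h - m)\<close>. In the window \<open>m \<le> \<tau> - t\<close> makes this at least
  the reward; for \<open>\<tau> \<ge> t + h\<close> the reward is only 1.\<close>

lemma gain_le:
  assumes "j \<in> S"
  shows "coef \<tau> i j + val (\<tau> - t) (S - {j}) \<le> val (\<tau> - t) S + bonus \<tau> S i"
proof (cases "j \<in> J")
  case False
  then show ?thesis
    by (simp add: coef_def val_remove_outside bonus_nonneg)
next
  case True
  show ?thesis
    using True n_ge_2 card_int_J_le[of S]
    by (auto simp: val_remove[OF assms True] coef_def bonus_def forced_def not_le
        intro!: power_increasing)
qed

section \<open>Actions without loss of potential\<close>

lemma tight_None: "tight \<tau> S i None \<longleftrightarrow> \<not> forced \<tau> S i"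
  using n_ge_2 by (auto simp: tight_def gain_def bonus_def)

lemma tight_outside: "j \<in> S \<Longrightarrow> j \<notin> J \<Longrightarrow> tight \<tau> S i (Some j) \<longleftrightarrow> \<not> forced \<tau> S i"
  using n_ge_2 by (auto simp: tight_def gain_def bonus_def coef_def val_remove_outside)

lemma tight_before:
  assumes "j \<in> S" "\<tau> < t"
  shows "tight \<tau> S i (Some j)"
  using assms by (simp add: tight_def gain_def bonus_def forced_def coef_def val_def)

text \<open>While \<open>J\<close> is intact, the reward 1 equals the loss
  \<open>n ^ (h - h)\<close>.\<close>

lemma tight_early:
  assumes "j \<in> J" "J \<subseteq> S" "t + h \<le> \<tau>"
  shows "tight \<tau> S i (Some j)"
proof -
  have "j \<in> S" "S \<inter> J = J" using assms by auto
  then show ?thesis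
    using assms val_remove[of j S "\<tau> - t"]
    by (simp add: tight_def gain_def bonus_def forced_def coef_def card_J)
qed

text \<open>The ad is surplus, so there is no loss, and the reward of any type is exactly its
  bonus.\<close>

lemma tight_window:
  assumes "j \<in> S" "j \<in> J" "t \<le> \<tau>" "\<tau> < t + h" "\<tau> - t < card (S \<inter> J)"
  shows "tight \<tau> S i (Some j)"
  using assms val_remove[of j S "\<tau> - t"]
  by (simp add: tight_def gain_def bonus_def forced_def coef_def)

text \<open>There is no bonus, and the reward equals the loss because
  \<open>h - (\<tau> - t) = t + h - \<tau>\<close>. An ad of \<open>J\<close> being present, this
  occurs only for \<open>\<tau> > t\<close>, which is why stage \<open>t\<close> is special
  later.\<close>

lemma tight_indifferent:
  assumes "j \<in> S" "j \<in> J" "t \<le> \<tau>" "\<tau> < t + h" "card (S \<inter> J) = \<tau> - t"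
  shows "tight \<tau> S (s \<tau>) (Some j)"
  using assms val_remove[of j S "\<tau> - t"]
  by (simp add: tight_def gain_def bonus_def forced_def coef_def add.commute)

section \<open>Reward plus potential in one stage\<close>

text \<open>Reward of the stage plus potential of the states it leads to. Since \<open>X\<close> is
  indexed by the remaining set, \<open>Y S\<close> and \<open>X S\<close> together are the mass that
  moves to \<open>S\<close>.\<close>

definition stage_value ::
  "nat \<Rightarrow> ('v set \<Rightarrow> 'i \<Rightarrow> 'v \<Rightarrow> real) \<Rightarrow> ('v set \<Rightarrow> 'i \<Rightarrow> real) \<Rightarrow> real"
  where "stage_value \<tau> X Y = (\<Sum>k\<in>UNIV. \<Sum>S\<in>UNIV. \<Sum>j\<in>-S. coef \<tau> k j * X S k j)
    + (\<Sum>S\<in>UNIV. ((\<Sum>k\<in>UNIV. Y S k) + (\<Sum>k\<in>UNIV. \<Sum>j\<in>-S. X S k j)) * val (\<tau> - t) S)"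

text \<open>Regrouping by the state before the action allows the Bellman inequality to be applied
  state by state.\<close>

lemma stage_value_eq:
  "stage_value \<tau> X Y = (\<Sum>k\<in>UNIV. \<Sum>S\<in>UNIV. Y S k * val (\<tau> - t) S
      + (\<Sum>j\<in>S. X (S - {j}) k j * (coef \<tau> k j + val (\<tau> - t) (S - {j}))))"
proof -
  let ?v = "val (\<tau> - t)"
  have "(\<Sum>S\<in>UNIV. ((\<Sum>k\<in>UNIV. Y S k) + (\<Sum>k\<in>UNIV. \<Sum>j\<in>-S. X S k j)) * ?v S)
      = (\<Sum>S\<in>UNIV. \<Sum>k\<in>UNIV. Y S k * ?v S + (\<Sum>j\<in>-S. X S k j * ?v S))"
    by (simp add: distrib_right sum.distrib sum_distrib_right)
  also have "\<dots> = (\<Sum>k\<in>UNIV. \<Sum>S\<in>UNIV. Y S k * ?v S + (\<Sum>j\<in>-S. X S k j * ?v S))"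
    by (rule sum.swap)
  finally have "stage_value \<tau> X Y = (\<Sum>k\<in>UNIV. (\<Sum>S\<in>UNIV. Y S k * ?v S)
      + (\<Sum>S\<in>UNIV. \<Sum>j\<in>-S. X S k j * (coef \<tau> k j + ?v S)))"
    unfolding stage_value_def by (simp add: sum.distrib algebra_simps)
  also have "\<dots> = (\<Sum>k\<in>UNIV. (\<Sum>S\<in>UNIV. Y S k * ?v S)
      + (\<Sum>S\<in>UNIV. \<Sum>j\<in>S. X (S - {j}) k j * (coef \<tau> k j + ?v (S - {j}))))"
    by (subst sum_sets_reindex) simp
  also have "\<dots> = (\<Sum>k\<in>UNIV. \<Sum>S\<in>UNIV. Y S k * ?v S
      + (\<Sum>j\<in>S. X (S - {j}) k j * (coef \<tau> k j + ?v (S - {j}))))"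
    by (simp add: sum.distrib)
  finally show ?thesis .
qed

lemma sum_val_Suc:
  assumes "\<tau> \<ge> 1"
  shows "(\<Sum>S\<in>UNIV. M S * val (Suc \<tau> - t) S) =
    (\<Sum>k::'i\<in>UNIV. \<Sum>S\<in>UNIV. M S / real n * (val (\<tau> - t) S + bonus \<tau> S k))"
proof -
  have "M S * val (Suc \<tau> - t) S
      = (\<Sum>k::'i\<in>UNIV. M S / real n * (val (\<tau> - t) S + bonus \<tau> S k))" for S
    using n_ge_2
    by (simp add: val_Suc[OF assms] sum.distrib card_i distrib_left sum_distrib_left
        flip: sum_divide_distrib)
  then show ?thesis
    by (simp add: sum.swap[of _ "UNIV :: 'i set"])
qed

text \<open>Every action is worth at most \<open>val + bonus\<close>, and the actions for one type
  in \<open>S\<close> share at most the mass \<open>M S / n\<close>.\<close>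

lemma stage_value_le:
  assumes "\<tau> \<ge> 1"
    and X: "\<And>S k j. X S k j \<ge> 0" and Y: "\<And>S k. Y S k \<ge> 0"
    and le: "\<And>S k. (\<Sum>j\<in>S. X (S - {j}) k j) + Y S k \<le> M S / real n"
  shows "stage_value \<tau> X Y \<le> (\<Sum>S\<in>UNIV. M S * val (Suc \<tau> - t) S)"
  unfolding stage_value_eq sum_val_Suc[OF \<open>\<tau> \<ge> 1\<close>]
proof (intro sum_mono)
  fix k S
  let ?v = "val (\<tau> - t)" and ?B = "val (\<tau> - t) S + bonus \<tau> S k"
  have "Y S k * ?v S \<le> Y S k * ?B"
    by (intro mult_left_mono Y) (simp add: bonus_nonneg)
  moreover have "(\<Sum>j\<in>S. X (S - {j}) k j * (coef \<tau> k j + ?v (S - {j})))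
      \<le> (\<Sum>j\<in>S. X (S - {j}) k j * ?B)"
    by (intro sum_mono mult_left_mono X gain_le)
  moreover have "Y S k * ?B + (\<Sum>j\<in>S. X (S - {j}) k j * ?B)
      = ((\<Sum>j\<in>S. X (S - {j}) k j) + Y S k) * ?B"
    by (simp add: sum_distrib_right distrib_right)
  moreover have "\<dots> \<le> M S / real n * ?B"
    by (intro mult_right_mono le add_nonneg_nonneg val_nonneg bonus_nonneg)
  ultimately show "Y S k * ?v S + (\<Sum>j\<in>S. X (S - {j}) k j * (coef \<tau> k j + ?v (S - {j})))
      \<le> M S / real n * ?B"
    by linarith
qed

text \<open>Complementary slackness: if only tight actions carry mass and all mass is spent, the
  estimates of weak duality become equalities.\<close>

lemma stage_value_tight:
  assumes "\<tau> \<ge> 1"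
    and X: "\<And>S k j. j \<in> S \<Longrightarrow> X (S - {j}) k j \<noteq> 0 \<Longrightarrow> tight \<tau> S k (Some j)"
    and Y: "\<And>S k. Y S k \<noteq> 0 \<Longrightarrow> tight \<tau> S k None"
    and eq: "\<And>S k. (\<Sum>j\<in>S. X (S - {j}) k j) + Y S k = M S / real n"
  shows "stage_value \<tau> X Y = (\<Sum>S\<in>UNIV. M S * val (Suc \<tau> - t) S)"
  unfolding stage_value_eq sum_val_Suc[OF \<open>\<tau> \<ge> 1\<close>]
proof (intro sum.cong refl)
  fix k S
  let ?v = "val (\<tau> - t)" and ?B = "val (\<tau> - t) S + bonus \<tau> S k"
  have "Y S k * ?v S = Y S k * ?B"
    using Y[of S k] by (auto simp: tight_def gain_def)
  moreover have "(\<Sum>j\<in>S. X (S - {j}) k j * (coef \<tau> k j + ?v (S - {j})))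
      = (\<Sum>j\<in>S. X (S - {j}) k j * ?B)"
    using X[of _ S k] by (intro sum.cong) (auto simp: tight_def gain_def)
  moreover have "Y S k * ?B + (\<Sum>j\<in>S. X (S - {j}) k j * ?B)
      = ((\<Sum>j\<in>S. X (S - {j}) k j) + Y S k) * ?B"
    by (simp add: sum_distrib_right distrib_right)
  ultimately show "Y S k * ?v S + (\<Sum>j\<in>S. X (S - {j}) k j * (coef \<tau> k j + ?v (S - {j})))
      = M S / real n * ?B"
    by (simp only: eq)
qed

section \<open>Validity of the inequality\<close>

definition lhs :: "('i, 'v) prob_vec \<Rightarrow> real"
  where "lhs z = (\<Sum>\<tau>=t+h..n. Z UNIV J \<tau> z)
        + (\<Sum>\<tau>=t..t+h-1. real n ^ (t + h - \<tau>) * Z {s \<tau>} J \<tau> z)"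

lemma lhs_eq:
  "lhs z = (\<Sum>\<tau>=1..n. \<Sum>k\<in>UNIV. \<Sum>j\<in>UNIV. coef \<tau> k j * z $ (k, j, Abs_stage \<tau>))"
proof -
  let ?g = "\<lambda>\<tau>. \<Sum>k\<in>UNIV. \<Sum>j\<in>UNIV. coef \<tau> k j * z $ (k, j, Abs_stage \<tau>)"
  have J: "(\<Sum>j\<in>UNIV. if j \<in> J then f j else 0) = sum f J" for f :: "'v \<Rightarrow> real"
    by (simp add: sum.If_cases)
  have early: "?g \<tau> = Z UNIV J \<tau> z" if "t + h \<le> \<tau>" for \<tau>
    using that unfolding Z_def by (subst J[symmetric]) (intro sum.cong, auto simp: coef_def)
  have window: "?g \<tau> = real n ^ (t + h - \<tau>) * Z {s \<tau>} J \<tau> z" if "t \<le> \<tau>" "\<tau> < t + h" for \<tau>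
  proof -
    have "?g \<tau> = (\<Sum>k\<in>UNIV. if k = s \<tau>
        then \<Sum>j\<in>J. real n ^ (t + h - \<tau>) * z $ (k, j, Abs_stage \<tau>) else 0)"
      using that by (intro sum.cong refl) (subst J[symmetric], auto simp: coef_def intro!: sum.cong)
    then show ?thesis
      by (simp add: Z_def sum_distrib_left)
  qed
  have zero: "?g \<tau> = 0" if "\<tau> < t" for \<tau>
    using that by (intro sum.neutral ballI) (auto simp: coef_def)
  have "{1..n} = {1..<t} \<union> ({t..t+h-1} \<union> {t+h..n})"
    using t_pos h_pos th_le by auto
  then have "sum ?g {1..n} = sum ?g {1..<t} + (sum ?g {t..t+h-1} + sum ?g {t+h..n})"
    using h_pos by (simp, subst sum.union_disjoint, (auto)[3], subst sum.union_disjoint, auto)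
  moreover have "sum ?g {1..<t} = 0"
    by (intro sum.neutral ballI zero) simp
  moreover have "sum ?g {t+h..n} = (\<Sum>\<tau>=t+h..n. Z UNIV J \<tau> z)"
    by (intro sum.cong refl early) simp
  moreover have "sum ?g {t..t+h-1} = (\<Sum>\<tau>=t..t+h-1. real n ^ (t + h - \<tau>) * Z {s \<tau>} J \<tau> z)"
    using h_pos by (intro sum.cong refl window) auto
  ultimately show ?thesis
    by (simp add: lhs_def)
qed

definition rhs :: real
  where "rhs = 1 + (\<Sum>\<tau>=1..h-1. real n ^ \<tau>)"

text \<open>At the outset \<open>J\<close> is intact and more than \<open>h\<close> stages with
  number at least \<open>t\<close> remain, so all \<open>h\<close> powers occur, in reverse
  order.\<close>

lemma val_start: "val (Suc n - t) UNIV = rhs"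
proof -
  have "val (Suc n - t) UNIV = (\<Sum>l<h. real n ^ (h - Suc l))"
    using th_le by (simp add: val_def card_J)
  also have "\<dots> = (\<Sum>l<h. real n ^ l)"
    by (rule sum.nat_diff_reindex)
  also have "{..<h} = insert 0 {1..h-1}"
    using h_pos by auto
  finally show ?thesis
    by (simp add: rhs_def)
qed

lemma val_end: "val (Suc 0 - t) S = 0"
  using t_pos by (simp add: val_def)

text \<open>The relation \<open>R\<close> lets one telescoping argument serve both the bound for
  feasible points and the equality for tight policies.\<close>

lemma sum_stages_telescope:
  fixes g \<Phi> :: "nat \<Rightarrow> real"
  assumes "\<And>\<tau>. \<tau> \<in> {1..n} \<Longrightarrow> R (g \<tau> + \<Phi> (\<tau> - 1)) (\<Phi> \<tau>)"
    and "R = (=) \<or> R = (\<le>)"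
  shows "R ((\<Sum>\<tau>=1..n. g \<tau>) + \<Phi> 0) (\<Phi> n)"
proof -
  have "m \<le> n \<Longrightarrow> R ((\<Sum>\<tau>=1..m. g \<tau>) + \<Phi> 0) (\<Phi> m)" for m
  proof (induction m)
    case 0
    then show ?case using assms(2) by auto
  next
    case (Suc m)
    then show ?case
      using assms(1)[of "Suc m"] assms(2) by auto
  qed
  then show ?thesis by simp
qed

text \<open>Weak duality: in each stage the potential of the mass drops by at least the reward
  collected.\<close>

lemma lhs_le:
  assumes "z \<in> achievable"
  shows "lhs z \<le> rhs"
proof -
  obtain x y where f: "feasible x y"
    and z: "\<And>i j \<tau>. \<tau> \<in> {1..CARD('i)} \<Longrightarrow>
      z $ (i, j, Abs_stage \<tau>) = (\<Sum>S | x_index \<tau> S j. x \<tau> S i j)"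
    using assms unfolding achievable_def by blast
  \<comment> \<open>Extension by zero lets the sums run over all sets.\<close>
  define X where "X \<tau> S k j = (if x_index \<tau> S j then x \<tau> S k j else 0)" for \<tau> S k j
  \<comment> \<open>At stage 1 no constraint bounds \<open>y\<close> from above, so it is replaced
    by zero; it does not enter \<open>z\<close>.\<close>
  define Y where "Y \<tau> S k = (if y_index \<tau> S \<and> \<tau> \<noteq> 1 then y \<tau> S k else 0)" for \<tau> S k
  \<comment> \<open>The mass available in state \<open>S\<close> at stage \<open>\<tau>\<close>:
    initially all of it sits in the full set, later it is the outflow of stage
    \<open>Suc \<tau>\<close>.\<close>
  define M where "M \<tau> S = (if \<tau> = n then of_bool (S = UNIV) else
    (\<Sum>k\<in>UNIV. Y (Suc \<tau>) S k) + (\<Sum>k\<in>UNIV. \<Sum>j\<in>-S. X (Suc \<tau>) S k j))" for \<tau> S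
  define \<Phi> where "\<Phi> \<tau> = (\<Sum>S\<in>UNIV. M \<tau> S * val (Suc \<tau> - t) S)" for \<tau>
  note f' = f[unfolded feasible_def Let_def card_i]
  have X0: "X \<tau> S k j \<ge> 0" and Y0: "Y \<tau> S k \<ge> 0" if "\<tau> \<in> {1..n}" for \<tau> S k j
    using f' that by (auto simp: X_def Y_def)
  have M0: "M \<tau> S \<ge> 0" if "\<tau> \<in> {1..n}" for \<tau> S
    using that by (auto simp: M_def intro!: add_nonneg_nonneg sum_nonneg X0 Y0)
  have stage_mass: "(\<Sum>j\<in>S. X \<tau> (S - {j}) k j) + Y \<tau> S k \<le> M \<tau> S / real n"
    if \<tau>: "\<tau> \<in> {1..n}" for \<tau> S k
  proof (cases "card S < \<tau>")
    case True
    \<comment> \<open>A match in \<open>S\<close> would leave fewer than \<open>\<tau> - 1\<close>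
      ads, and for such sets there is no variable.\<close>
    have "X \<tau> (S - {j}) k j = 0" if "j \<in> S" for j
    proof -
      have "card (S - {j}) < card S" using that by (intro card_Diff1_less) auto
      then show ?thesis using True by (auto simp: X_def x_index_def)
    qed
    then have "(\<Sum>j\<in>S. X \<tau> (S - {j}) k j) = 0" by simp
    then show ?thesis
      using True M0[OF \<tau>, of S] by (simp add: Y_def y_index_def)
  next
    case False
    then have S: "S \<noteq> {}" using \<tau> by auto
    have xs: "(\<Sum>j\<in>S. X \<tau> (S - {j}) k j) = (\<Sum>j\<in>S. x \<tau> (S - {j}) k j)"
      using False by (intro sum.cong) (auto simp: X_def x_index_def card_Diff_singleton)
    have ys: "Y \<tau> S k = y \<tau> S k * of_bool (\<tau> \<noteq> 1)"
      using False by (simp add: Y_def y_index_def)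
    show ?thesis
    proof (cases "\<tau> = n")
      case True
      then have "S = UNIV"
        using False card_v by (metis card_mono card_subset_eq finite leI le_antisym subset_UNIV)
      then show ?thesis
        unfolding xs ys M_def using f' True n_ge_2 by simp
    next
      case False': False
      have Xs: "(\<Sum>j\<in>-S. X (Suc \<tau>) S l j) = (\<Sum>j\<in>UNIV - S. x (Suc \<tau>) S l j)" for l
        using False by (intro sum.cong) (auto simp: X_def x_index_def)
      \<comment> \<open>The indicator in the constraint is the index condition of \<open>y\<close>
        at stage \<open>Suc \<tau>\<close>.\<close>
      have Ys: "(\<Sum>k\<in>UNIV. Y (Suc \<tau>) S k) = of_bool (\<tau> < card S) * (\<Sum>k\<in>UNIV. y (Suc \<tau>) S k)"
        using \<tau> by (auto simp: Y_def y_index_def)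
      have \<tau>': "\<tau> \<in> {1..n-1}" using \<tau> False' by auto
      have M: "M \<tau> S / real n = 1 / real n * of_bool (card S > \<tau>) * (\<Sum>k\<in>UNIV. y (\<tau> + 1) S k)
         + 1 / real n * (\<Sum>k\<in>UNIV. \<Sum>j\<in>UNIV - S. x (\<tau> + 1) S k j)"
        using False' by (simp add: M_def Xs Ys add_divide_distrib)
      show ?thesis
      proof (cases "S = UNIV")
        case True
        have "(\<Sum>j\<in>UNIV. x \<tau> (UNIV - {j}) k j) + y \<tau> UNIV k * of_bool (\<tau> \<noteq> 1)
          - 1 / real n * (\<Sum>k\<in>UNIV. y (\<tau> + 1) UNIV k) \<le> 0"
          using f'[THEN conjunct2, THEN conjunct2, THEN conjunct2, THEN conjunct2, rule_format, OF \<tau>']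
          by blast
        moreover have "\<tau> < n" using \<tau> False' by simp
        ultimately show ?thesis
          unfolding xs ys M using True by (simp add: card_v)
      next
        case S': False
        then have "S \<subset> UNIV" by auto
        then have "(\<Sum>j\<in>S. x \<tau> (S - {j}) k j) + y \<tau> S k * of_bool (\<tau> \<noteq> 1)
           - 1 / real n * of_bool (card S > \<tau>) * (\<Sum>k\<in>UNIV. y (\<tau> + 1) S k)
           - 1 / real n * (\<Sum>k\<in>UNIV. \<Sum>j\<in>UNIV - S. x (\<tau> + 1) S k j) \<le> 0"
          using S False
          by (intro f'[THEN conjunct2, THEN conjunct2, THEN conjunct2, THEN conjunct1, THEN bspec,
                OF \<tau>', THEN spec[where x = k], THEN spec[where x = S], THEN mp] conjI) auto
        then show ?thesis
          unfolding xs ys M by linarith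
      qed
    qed
  qed
  define g where "g \<tau> = (\<Sum>k\<in>UNIV. \<Sum>S\<in>UNIV. \<Sum>j\<in>-S. coef \<tau> k j * X \<tau> S k j)" for \<tau>
  have "g \<tau> + \<Phi> (\<tau> - 1) \<le> \<Phi> \<tau>" if \<tau>: "\<tau> \<in> {1..n}" for \<tau>
  proof -
    have "M (\<tau> - 1) S = (\<Sum>k\<in>UNIV. Y \<tau> S k) + (\<Sum>k\<in>UNIV. \<Sum>j\<in>-S. X \<tau> S k j)" for S
      using \<tau> by (auto simp: M_def)
    moreover have "Suc (\<tau> - 1) = \<tau>" "\<tau> \<ge> 1" using \<tau> by auto
    ultimately show ?thesis
      using stage_value_le[of \<tau> "X \<tau>" "Y \<tau>" "M \<tau>"] X0[OF \<tau>] Y0[OF \<tau>] stage_mass[OF \<tau>]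
      by (simp add: \<Phi>_def g_def stage_value_def)
  qed
  then have "(\<Sum>\<tau>=1..n. g \<tau>) + \<Phi> 0 \<le> \<Phi> n"
    by (rule sum_stages_telescope) auto
  moreover have "\<Phi> 0 = 0"
    unfolding \<Phi>_def val_end by simp
  moreover have "\<Phi> n = rhs"
    by (simp add: \<Phi>_def M_def val_start of_bool_def if_distrib[where f = "\<lambda>x. x * _"] cong: if_cong)
  moreover have "(\<Sum>\<tau>=1..n. g \<tau>) = lhs z"
    unfolding lhs_eq
  proof (rule sum.cong[OF refl])
    fix \<tau> assume \<tau>: "\<tau> \<in> {1..n}"
    have "(\<Sum>S\<in>UNIV. \<Sum>j\<in>-S. coef \<tau> k j * X \<tau> S k j)
        = (\<Sum>j\<in>UNIV. coef \<tau> k j * z $ (k, j, Abs_stage \<tau>))" for k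
    proof -
      have "(\<Sum>S\<in>UNIV. \<Sum>j\<in>-S. coef \<tau> k j * X \<tau> S k j)
          = (\<Sum>S\<in>UNIV. \<Sum>j\<in>UNIV. coef \<tau> k j * X \<tau> S k j)"
        by (intro sum.cong refl sum.mono_neutral_left) (auto simp: X_def x_index_def)
      also have "\<dots> = (\<Sum>j\<in>UNIV. \<Sum>S\<in>UNIV. coef \<tau> k j * X \<tau> S k j)"
        by (rule sum.swap)
      also have "\<dots> = (\<Sum>j\<in>UNIV. coef \<tau> k j * z $ (k, j, Abs_stage \<tau>))"
        using \<tau> by (simp add: z card_i X_def sum.If_cases flip: sum_distrib_left)
      finally show ?thesis .
    qed
    then show "g \<tau> = (\<Sum>k\<in>UNIV. \<Sum>j\<in>UNIV. coef \<tau> k j * z $ (k, j, Abs_stage \<tau>))"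
      by (simp add: g_def)
  qed
  ultimately show ?thesis by simp
qed

subsection \<open>Policies\<close>

text \<open>Stages count down, so the recursion is over the number \<open>m\<close> of stages
  already played.\<close>

primrec occupancy :: "('i, 'v) policy \<Rightarrow> nat \<Rightarrow> 'v set \<Rightarrow> real" where
  "occupancy \<pi> 0 S = of_bool (S = UNIV)"
| "occupancy \<pi> (Suc m) S =
    (\<Sum>i\<in>UNIV. \<Sum>S'\<in>UNIV. occupancy \<pi> m S' / real n * of_bool (successor S' (\<pi> (n - m) S' i) = S))"

definition state_prob :: "('i, 'v) policy \<Rightarrow> nat \<Rightarrow> 'v set \<Rightarrow> real"
  where "state_prob \<pi> \<tau> = occupancy \<pi> (n - \<tau>)"

definition match_prob :: "('i, 'v) policy \<Rightarrow> nat \<Rightarrow> 'v set \<Rightarrow> 'i \<Rightarrow> 'v \<Rightarrow> real"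
  where "match_prob \<pi> \<tau> S i j =
    state_prob \<pi> \<tau> (insert j S) / real n * of_bool (\<pi> \<tau> (insert j S) i = Some j)"

definition discard_prob :: "('i, 'v) policy \<Rightarrow> nat \<Rightarrow> 'v set \<Rightarrow> 'i \<Rightarrow> real"
  where "discard_prob \<pi> \<tau> S i = state_prob \<pi> \<tau> S / real n * of_bool (\<pi> \<tau> S i = None)"

definition outcome :: "('i, 'v) policy \<Rightarrow> ('i, 'v) prob_vec"
  where "outcome \<pi> = vec_lambda (\<lambda>(i, j, \<sigma>).
    \<Sum>S | x_index (stage_no \<sigma>) S j. match_prob \<pi> (stage_no \<sigma>) S i j)"

text \<open>Tightness is demanded in all states, reachable or not, so that it survives any change to
  another tight action.\<close>

definition tight_policy :: "('i, 'v) policy \<Rightarrow> bool"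
  where "tight_policy \<pi> \<longleftrightarrow> (\<forall>\<tau> S i. tight \<tau> S i (\<pi> \<tau> S i))"

lemma tight_policy_SomeD: "tight_policy \<pi> \<Longrightarrow> \<pi> \<tau> S i = Some j \<Longrightarrow> j \<in> S"
  unfolding tight_policy_def tight_def by (metis option.set_intros subsetD)

lemma state_prob_top: "state_prob \<pi> n S = of_bool (S = UNIV)"
  by (simp add: state_prob_def)

lemma state_prob_step:
  assumes "\<tau> \<in> {1..n}"
  shows "state_prob \<pi> (\<tau> - 1) S =
    (\<Sum>i\<in>UNIV. \<Sum>S'\<in>UNIV. state_prob \<pi> \<tau> S' / real n * of_bool (successor S' (\<pi> \<tau> S' i) = S))"
proof -
  have "n - (\<tau> - 1) = Suc (n - \<tau>)" "n - (n - \<tau>) = \<tau>" using assms by auto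
  then show ?thesis by (simp add: state_prob_def)
qed

lemma state_prob_nonneg: "state_prob \<pi> \<tau> S \<ge> 0"
proof -
  have "occupancy \<pi> m S \<ge> 0" for m
    by (induction m arbitrary: S) (auto intro!: sum_nonneg)
  then show ?thesis by (simp add: state_prob_def)
qed

lemma stage_mass:
  assumes "tight_policy \<pi>"
  shows "(\<Sum>j\<in>S. match_prob \<pi> \<tau> (S - {j}) i j) + discard_prob \<pi> \<tau> S i = state_prob \<pi> \<tau> S / real n"
proof -
  have "(\<Sum>j\<in>S. match_prob \<pi> \<tau> (S - {j}) i j)
      = (\<Sum>j\<in>S. state_prob \<pi> \<tau> S / real n * of_bool (\<pi> \<tau> S i = Some j))"
    by (intro sum.cong) (auto simp: match_prob_def insert_absorb)
  also have "\<dots> = state_prob \<pi> \<tau> S / real n * of_bool (\<pi> \<tau> S i \<noteq> None)"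
    using tight_policy_SomeD[OF assms]
    by (cases "\<pi> \<tau> S i") (auto simp: of_bool_def if_distrib cong: if_cong)
  finally show ?thesis
    by (simp add: discard_prob_def)
qed

text \<open>The next state is \<open>S\<close> either after discarding in \<open>S\<close> or after
  matching some \<open>j\<close> in the state \<open>insert j S\<close>.\<close>

lemma stage_flow:
  assumes "tight_policy \<pi>" "\<tau> \<in> {1..n}"
  shows "state_prob \<pi> (\<tau> - 1) S =
    (\<Sum>i\<in>UNIV. discard_prob \<pi> \<tau> S i) + (\<Sum>i\<in>UNIV. \<Sum>j\<in>-S. match_prob \<pi> \<tau> S i j)"
proof -
  let ?P = "\<lambda>S. state_prob \<pi> \<tau> S / real n"
  have "(\<Sum>S'\<in>UNIV. ?P S' * of_bool (successor S' (\<pi> \<tau> S' i) = S))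
      = discard_prob \<pi> \<tau> S i + (\<Sum>j\<in>-S. match_prob \<pi> \<tau> S i j)" for i
  proof -
    have "(\<Sum>S'\<in>UNIV. ?P S' * of_bool (successor S' (\<pi> \<tau> S' i) = S))
      = (\<Sum>S'\<in>UNIV. ?P S' * of_bool (\<pi> \<tau> S' i = None \<and> S' = S)
        + (\<Sum>j\<in>S'. ?P S' * of_bool (\<pi> \<tau> S' i = Some j \<and> S' - {j} = S)))"
    proof (rule sum.cong[OF refl])
      fix S'
      show "?P S' * of_bool (successor S' (\<pi> \<tau> S' i) = S) =
        ?P S' * of_bool (\<pi> \<tau> S' i = None \<and> S' = S)
        + (\<Sum>j\<in>S'. ?P S' * of_bool (\<pi> \<tau> S' i = Some j \<and> S' - {j} = S))"
      proof (cases "\<pi> \<tau> S' i")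
        case None
        then show ?thesis by simp
      next
        case (Some a)
        then have "a \<in> S'" by (rule tight_policy_SomeD[OF assms(1)])
        moreover have "(\<Sum>j\<in>S'. ?P S' * of_bool (\<pi> \<tau> S' i = Some j \<and> S' - {j} = S))
          = (\<Sum>j\<in>S'. if a = j then ?P S' * of_bool (S' - {a} = S) else 0)"
          using Some by (intro sum.cong) auto
        ultimately show ?thesis using Some by simp
      qed
    qed
    also have "\<dots> = (\<Sum>S'\<in>UNIV. ?P S' * of_bool (\<pi> \<tau> S' i = None \<and> S' = S))
        + (\<Sum>S'\<in>UNIV. \<Sum>j\<in>-S'. ?P (insert j S') * of_bool (\<pi> \<tau> (insert j S') i = Some j \<and> S' = S))"
      unfolding sum.distrib by (subst sum_sets_reindex) simp
    also have "(\<Sum>S'\<in>UNIV. ?P S' * of_bool (\<pi> \<tau> S' i = None \<and> S' = S))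
        = (\<Sum>S'\<in>UNIV. if S' = S then discard_prob \<pi> \<tau> S' i else 0)"
      by (intro sum.cong) (auto simp: discard_prob_def)
    also have "(\<Sum>S'\<in>UNIV. \<Sum>j\<in>-S'. ?P (insert j S') * of_bool (\<pi> \<tau> (insert j S') i = Some j \<and> S' = S))
        = (\<Sum>S'\<in>UNIV. if S' = S then \<Sum>j\<in>-S'. match_prob \<pi> \<tau> S' i j else 0)"
      by (intro sum.cong) (auto simp: match_prob_def)
    finally show ?thesis
      by simp
  qed
  then show ?thesis
    by (simp only: state_prob_step[OF assms(2)] sum.distrib)
qed

text \<open>Each stage uses at most one ad. Hence no probability lies where the polyhedron has no
  variables.\<close>

lemma state_prob_support:
  assumes "tight_policy \<pi>" "\<tau> \<le> n" "card S < \<tau>"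
  shows "state_prob \<pi> \<tau> S = 0"
proof -
  have "card S < n - m \<Longrightarrow> m \<le> n \<Longrightarrow> occupancy \<pi> m S = 0" for m
  proof (induction m arbitrary: S)
    case 0
    then show ?case using card_v by auto
  next
    case (Suc m)
    have "occupancy \<pi> m S' = 0" if "successor S' A = S" for S' A
    proof (rule Suc.IH)
      have "card S' \<le> Suc (card S)"
        using that by (cases A) (auto simp: card_Diff_singleton_if)
      then show "card S' < n - m" "m \<le> n" using Suc.prems by auto
    qed
    then show ?case by (auto intro!: sum.neutral)
  qed
  from this[of "n - \<tau>"] show ?thesis
    using assms by (simp add: state_prob_def)
qed

section \<open>Policies as points of the polyhedron\<close>

lemma match_prob_nonneg: "match_prob \<pi> \<tau> S i j \<ge> 0"
  and discard_prob_nonneg: "discard_prob \<pi> \<tau> S i \<ge> 0"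
  by (simp_all add: match_prob_def discard_prob_def state_prob_nonneg)

text \<open>Conservation of probability gives the constraints with equality, up to the discards of
  stage 1.\<close>

lemma feasible_policy:
  assumes "tight_policy \<pi>"
  shows "feasible (match_prob \<pi>) (discard_prob \<pi>)"
proof -
  let ?x = "match_prob \<pi>" and ?y = "discard_prob \<pi>"
  have le: "(\<Sum>j\<in>S. ?x \<tau> (S - {j}) i j) + ?y \<tau> S i * of_bool (\<tau> \<noteq> 1) \<le> state_prob \<pi> \<tau> S / real n"
    for \<tau> S i
    using discard_prob_nonneg[of \<pi> \<tau> S i] stage_mass[OF assms, of \<tau> S i] by auto
  have flow: "state_prob \<pi> \<tau> S / real n = 1 / real n * of_bool (card S > \<tau>) * (\<Sum>k\<in>UNIV. ?y (\<tau> + 1) S k)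
       + 1 / real n * (\<Sum>k\<in>UNIV. \<Sum>j\<in>UNIV - S. ?x (\<tau> + 1) S k j)"
    if "\<tau> \<in> {1..n-1}" "card S \<ge> \<tau>" for \<tau> S
  proof -
    \<comment> \<open>The indicator drops nothing: a set of only \<open>\<tau>\<close> ads has
      probability zero at stage \<open>\<tau> + 1\<close>.\<close>
    have "\<not> \<tau> < card S \<Longrightarrow> ?y (\<tau> + 1) S k = 0" for k
      using that n_ge_2 state_prob_support[OF assms, of "\<tau> + 1" S]
      by (cases "Suc \<tau> \<le> n") (auto simp: discard_prob_def)
    moreover have "Suc \<tau> \<in> {1..n}" using that by auto
    ultimately show ?thesis
      using that stage_flow[OF assms, of "Suc \<tau>" S]
      by (cases "\<tau> < card S") (simp_all add: add_divide_distrib Compl_eq_Diff_UNIV)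
  qed
  have "(\<Sum>j\<in>UNIV. ?x n (UNIV - {j}) i j) + ?y n UNIV i \<le> 1 / real n" for i
    by (simp add: stage_mass[OF assms] state_prob_top)
  moreover have "(\<Sum>j\<in>S. ?x \<tau> (S - {j}) i j) + ?y \<tau> S i * of_bool (\<tau> \<noteq> 1)
       - 1 / real n * of_bool (card S > \<tau>) * (\<Sum>k\<in>UNIV. ?y (\<tau> + 1) S k)
       - 1 / real n * (\<Sum>k\<in>UNIV. \<Sum>j\<in>UNIV - S. ?x (\<tau> + 1) S k j) \<le> 0"
    if "\<tau> \<in> {1..n-1}" "card S \<ge> \<tau>" for \<tau> S i
    using le[where \<tau> = \<tau> and S = S and i = i] flow[OF that] by linarith
  moreover have "(\<Sum>j\<in>UNIV. ?x \<tau> (UNIV - {j}) i j) + ?y \<tau> UNIV i * of_bool (\<tau> \<noteq> 1)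
       - 1 / real n * (\<Sum>k\<in>UNIV. ?y (\<tau> + 1) UNIV k) \<le> 0"
    if "\<tau> \<in> {1..n-1}" for \<tau> i
  proof -
    have "\<tau> < n" using that by auto
    then show ?thesis
      using le[of \<tau> UNIV i] flow[OF that, of UNIV] by (simp add: card_v)
  qed
  ultimately show ?thesis
    unfolding feasible_def Let_def card_i
    by (intro conjI) (use match_prob_nonneg discard_prob_nonneg in blast)+
qed

lemma outcome_eq_sum_match:
  assumes "\<tau> \<in> {1..n}"
  shows "outcome \<pi> $ (i, j, Abs_stage \<tau>) = (\<Sum>S | x_index \<tau> S j. match_prob \<pi> \<tau> S i j)"
  using assms by (simp add: outcome_def Abs_stage_inverse card_i)

lemma outcome_achievable:
  assumes "tight_policy \<pi>"
  shows "outcome \<pi> \<in> achievable"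
  unfolding achievable_def
  using feasible_policy[OF assms] outcome_eq_sum_match card_i by blast

lemma outcome_eq:
  assumes "tight_policy \<pi>" "\<tau> \<in> {1..n}"
  shows "outcome \<pi> $ (i, j, Abs_stage \<tau>) = (\<Sum>S | j \<notin> S. match_prob \<pi> \<tau> S i j)"
  unfolding outcome_eq_sum_match[OF assms(2)]
proof (rule sum.mono_neutral_left)
  show "\<forall>S\<in>{S. j \<notin> S} - {S. x_index \<tau> S j}. match_prob \<pi> \<tau> S i j = 0"
  proof
    fix S assume S: "S \<in> {S. j \<notin> S} - {S. x_index \<tau> S j}"
    then have "card (insert j S) < \<tau>" by (auto simp: x_index_def)
    then show "match_prob \<pi> \<tau> S i j = 0"
      using assms(2) by (simp add: match_prob_def state_prob_support[OF assms(1)])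
  qed
qed (auto simp: x_index_def)

text \<open>Indexing by the state before the match makes two policies directly comparable.\<close>

lemma outcome_eq_state_prob:
  assumes "tight_policy \<pi>" "\<tau> \<in> {1..n}"
  shows "outcome \<pi> $ (i, j, Abs_stage \<tau>)
    = (\<Sum>S\<in>UNIV. state_prob \<pi> \<tau> S / real n * of_bool (\<pi> \<tau> S i = Some j))"
proof -
  have "outcome \<pi> $ (i, j, Abs_stage \<tau>)
    = (\<Sum>S | j \<in> S. state_prob \<pi> \<tau> S / real n * of_bool (\<pi> \<tau> S i = Some j))"
    unfolding outcome_eq[OF assms]
    by (rule sum.reindex_bij_witness[where i = "\<lambda>S. S - {j}" and j = "insert j"])
      (auto simp: match_prob_def insert_absorb)
  also have "\<dots> = (\<Sum>S\<in>UNIV. state_prob \<pi> \<tau> S / real n * of_bool (\<pi> \<tau> S i = Some j))"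
    using tight_policy_SomeD[OF assms(1)] by (intro sum.mono_neutral_left) auto
  finally show ?thesis .
qed

text \<open>Tight actions conserve reward plus potential, so the bound is attained.\<close>

lemma lhs_outcome:
  assumes "tight_policy \<pi>"
  shows "lhs (outcome \<pi>) = rhs"
proof -
  define \<Phi> where "\<Phi> \<tau> = (\<Sum>S\<in>UNIV. state_prob \<pi> \<tau> S * val (Suc \<tau> - t) S)" for \<tau>
  define g where "g \<tau> = (\<Sum>k\<in>UNIV. \<Sum>S\<in>UNIV. \<Sum>j\<in>-S. coef \<tau> k j * match_prob \<pi> \<tau> S k j)" for \<tau>
  have "g \<tau> + \<Phi> (\<tau> - 1) = \<Phi> \<tau>" if \<tau>: "\<tau> \<in> {1..n}" for \<tau>
  proof -
    have "stage_value \<tau> (match_prob \<pi> \<tau>) (discard_prob \<pi> \<tau>)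
        = (\<Sum>S\<in>UNIV. state_prob \<pi> \<tau> S * val (Suc \<tau> - t) S)"
    proof (rule stage_value_tight)
      show "1 \<le> \<tau>" using \<tau> by simp
      show "tight \<tau> S k (Some j)" if "j \<in> S" "match_prob \<pi> \<tau> (S - {j}) k j \<noteq> 0" for S k j
        using that assms by (auto simp: match_prob_def insert_absorb tight_policy_def split: if_splits)
          metis
      show "tight \<tau> S k None" if "discard_prob \<pi> \<tau> S k \<noteq> 0" for S k
        using that assms by (auto simp: discard_prob_def tight_policy_def split: if_splits) metis
    qed (rule stage_mass[OF assms])
    moreover have "Suc (\<tau> - 1) = \<tau>" using \<tau> by auto
    ultimately show ?thesis
      unfolding \<Phi>_def g_def stage_value_def stage_flow[OF assms \<tau>] by simp
  qed
  then have "(\<Sum>\<tau>=1..n. g \<tau>) + \<Phi> 0 = \<Phi> n"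
    by (rule sum_stages_telescope) auto
  moreover have "\<Phi> 0 = 0"
    unfolding \<Phi>_def val_end by simp
  moreover have "\<Phi> n = rhs"
    by (simp add: \<Phi>_def state_prob_top val_start of_bool_def if_distrib[where f = "\<lambda>x. x * _"] cong: if_cong)
  moreover have "(\<Sum>\<tau>=1..n. g \<tau>) = lhs (outcome \<pi>)"
    unfolding lhs_eq
  proof (rule sum.cong[OF refl])
    fix \<tau> assume \<tau>: "\<tau> \<in> {1..n}"
    show "g \<tau> = (\<Sum>k\<in>UNIV. \<Sum>j\<in>UNIV. coef \<tau> k j * outcome \<pi> $ (k, j, Abs_stage \<tau>))"
      unfolding g_def outcome_eq[OF assms \<tau>] sum_distrib_left Compl_eq
      using sum.swap_restrict[of UNIV UNIV "\<lambda>S j. coef \<tau> _ j * match_prob \<pi> \<tau> S _ j" "\<lambda>S j. j \<notin> S"]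
      by (intro sum.cong refl) simp
  qed
  ultimately show ?thesis by simp
qed

subsection \<open>Reachable states and the affine hull of the face\<close>

inductive reachable :: "nat \<Rightarrow> 'v set \<Rightarrow> bool" where
  start: "reachable n UNIV"
| step: "reachable \<tau> S \<Longrightarrow> \<tau> \<ge> 1 \<Longrightarrow> tight \<tau> S i A \<Longrightarrow> reachable (\<tau> - 1) (successor S A)"

text \<open>A tight policy to start from; its outcome is later the base point of the face.\<close>

definition greedy :: "('i, 'v) policy"
  where "greedy \<tau> S i = (if forced \<tau> S i then Some (SOME j. j \<in> S \<inter> J) else None)"

lemma tight_greedy: "tight_policy greedy"
  unfolding tight_policy_def
proof (intro allI)
  fix \<tau> S i
  show "tight \<tau> S i (greedy \<tau> S i)"
  proof (cases "forced \<tau> S i")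
    case True
    then have "S \<inter> J \<noteq> {}" by (auto simp: forced_def)
    then have "(SOME j. j \<in> S \<inter> J) \<in> S \<inter> J" by (rule some_in_eq[THEN iffD2])
    then show ?thesis
      using True by (simp add: greedy_def) (rule tight_window; simp add: forced_def)
  next
    case False
    then show ?thesis by (simp add: greedy_def tight_None)
  qed
qed

definition override :: "('i, 'v) policy \<Rightarrow> nat \<Rightarrow> 'v set \<Rightarrow> 'i \<Rightarrow> 'v option \<Rightarrow> ('i, 'v) policy"
  where "override \<pi> \<tau> S i A = (\<lambda>\<tau>' S' i'. if \<tau>' = \<tau> \<and> S' = S \<and> i' = i then A else \<pi> \<tau>' S' i')"

lemma tight_override:
  "tight_policy \<pi> \<Longrightarrow> tight \<tau> S i A \<Longrightarrow> tight_policy (override \<pi> \<tau> S i A)"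
  by (auto simp: tight_policy_def override_def)

text \<open>A change at stage \<open>\<tau>\<close> affects the states only at smaller stage
  numbers.\<close>

lemma state_prob_override:
  assumes "\<tau> \<le> \<tau>'" "\<tau>' \<le> n"
  shows "state_prob (override \<pi> \<tau> S i A) \<tau>' = state_prob \<pi> \<tau>'"
proof -
  have "m \<le> n - \<tau> \<Longrightarrow> occupancy (override \<pi> \<tau> S i A) m = occupancy \<pi> m" for m
  proof (induction m)
    case (Suc m)
    then have "n - m \<noteq> \<tau>" by auto
    with Suc show ?case
      by (auto simp: fun_eq_iff override_def)
  qed (simp add: fun_eq_iff)
  then show ?thesis using assms by (simp add: state_prob_def)
qed

text \<open>Positive probability makes an exchange in the state visible in the outcome. Prescribing
  \<open>A\<close> for type \<open>i\<close> in \<open>S\<close> passes at least the share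
  \<open>1 / n\<close> on to the successor.\<close>

lemma reachable_policy:
  "reachable \<tau> S \<Longrightarrow> \<tau> \<le> n \<and> (\<exists>\<pi>. tight_policy \<pi> \<and> state_prob \<pi> \<tau> S > 0)"
proof (induction rule: reachable.induct)
  case start
  then show ?case
    using tight_greedy by (auto simp: state_prob_top intro!: exI[of _ greedy])
next
  case (step \<tau> S i A)
  then obtain \<pi> where \<pi>: "\<tau> \<le> n" "tight_policy \<pi>" "state_prob \<pi> \<tau> S > 0" by auto
  define \<pi>' where "\<pi>' = override \<pi> \<tau> S i A"
  have pos: "state_prob \<pi>' \<tau> S > 0"
    using \<pi> by (simp add: \<pi>'_def state_prob_override)
  have A: "\<pi>' \<tau> S i = A" by (simp add: \<pi>'_def override_def)
  let ?g = "\<lambda>i S'. state_prob \<pi>' \<tau> S' / real n * of_bool (successor S' (\<pi>' \<tau> S' i) = successor S A)"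
  have g0: "?g i S' \<ge> 0" for i S'
    by (simp add: state_prob_nonneg)
  have "0 < ?g i S"
    using pos n_ge_2 by (simp add: A)
  also have "\<dots> \<le> (\<Sum>S'\<in>UNIV. ?g i S')"
    using g0 by (intro member_le_sum) auto
  also have "\<dots> \<le> (\<Sum>i\<in>UNIV. \<Sum>S'\<in>UNIV. ?g i S')"
    using g0 by (intro member_le_sum[of i UNIV "\<lambda>i. \<Sum>S'\<in>UNIV. ?g i S'"] sum_nonneg) auto
  also have "\<dots> = state_prob \<pi>' (\<tau> - 1) (successor S A)"
    using \<pi>(1) step.hyps by (subst state_prob_step) auto
  finally show ?case
    using \<pi> tight_override[OF \<pi>(2) step.hyps(3)] by (auto simp: \<pi>'_def)
qed

text \<open>As \<open>n \<ge> 2\<close>, each stage has a type other than \<open>s (Suc m)\<close>;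
  it is not forced and may be discarded.\<close>

lemma reachable_UNIV: "\<tau> \<le> n \<Longrightarrow> reachable \<tau> UNIV"
proof (induction rule: inc_induct)
  case base
  then show ?case by (rule reachable.start)
next
  case (step m)
  have "UNIV \<noteq> {s (Suc m)}"
  proof
    assume "UNIV = {s (Suc m)}"
    then have "CARD('i) = card {s (Suc m)}" by (rule arg_cong)
    then show False using card_i n_ge_2 by simp
  qed
  then obtain i where "i \<noteq> s (Suc m)" by auto
  then have "tight (Suc m) UNIV i None"
    by (simp add: tight_None forced_def)
  from reachable.step[OF step.IH _ this] show ?case by simp
qed

text \<open>Stage \<open>n\<close> precedes the window because \<open>t + h \<le> n\<close>. There
  \<open>j\<close> is matched, and then everything is discarded until the window begins.\<close>

lemma reachable_window_top:
  assumes "j \<in> J"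
  shows "reachable (t + h - 1) (- {j})"
proof -
  have "t + h - 1 \<le> n - 1" using th_le by simp
  then show ?thesis
  proof (induction rule: inc_induct)
    case base
    have "tight n UNIV i (Some j)" for i
      using assms th_le by (intro tight_early) auto
    from reachable.step[OF reachable.start _ this] show ?case
      using n_ge_2 by (simp add: Compl_eq_Diff_UNIV)
  next
    case (step m)
    have "tight (Suc m) (- {j}) i None" for i
      using step by (auto simp: tight_None forced_def)
    from reachable.step[OF step.IH _ this] show ?case by simp
  qed
qed

text \<open>
  The state with exactly \<open>k\<close> ads of \<open>J\<close> left at stage \<open>t + k\<close> is where matching and discarding
  \<open>s (t + k)\<close> are equally good.
\<close>
lemma reachable_indifferent:
  assumes "k \<le> h - 1" "K \<subseteq> J" "card K = k"
  shows "reachable (t + k) (- (J - K))"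
  using assms
proof (induction arbitrary: K rule: inc_induct)
  case base
  have "card (J - K) = 1"
    using base h_pos card_J by (simp add: card_Diff_subset finite_subset)
  then obtain j where j: "J - K = {j}" by (rule card_1_singletonE)
  then have "j \<in> J" by auto
  from reachable_window_top[OF this] show ?case
    using h_pos j by simp
next
  case (step k)
  have "J - K \<noteq> {}"
    using step.hyps step.prems card_J h_pos
    by (metis Diff_eq_empty_iff One_nat_def Suc_leI Suc_n_not_le_n Suc_pred less_Suc_eq_le
        subset_antisym order_less_imp_le not_less)
  then obtain j where j: "j \<in> J" "j \<notin> K" by auto
  have cK: "card (insert j K) = Suc k" using j step.prems by simp
  \<comment> \<open>By induction this indifferent state with one more ad is reachable one stage
    earlier; matching \<open>j\<close> there is tight and leads to the desired state.\<close>
  let ?S = "- (J - insert j K)"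
  have "reachable (t + Suc k) ?S"
    using step.prems j cK by (intro step.IH) auto
  moreover have "?S \<inter> J = insert j K" using j step.prems by auto
  then have "tight (t + Suc k) ?S (s (t + Suc k)) (Some j)"
    using j cK step.hyps h_pos by (intro tight_indifferent) auto
  ultimately have "reachable (t + Suc k - 1) (successor ?S (Some j))"
    by (intro reachable.step) auto
  moreover have "successor ?S (Some j) = - (J - K)" using j by auto
  ultimately show ?case by simp
qed

section \<open>Exchange vectors and the dimension of the face\<close>

text \<open>The zero vector for a discard puts exchanges of two matches and of a match with a
  discard into one form.\<close>

definition unit :: "'i \<Rightarrow> nat \<Rightarrow> 'v option \<Rightarrow> ('i, 'v) prob_vec"
  where "unit i \<tau> A = (case A of None \<Rightarrow> 0 | Some j \<Rightarrow> axis (i, j, Abs_stage \<tau>) 1)"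

definition face :: "('i, 'v) prob_vec set"
  where "face = {z \<in> achievable. lhs z = rhs}"

text \<open>A change in one state preserves the state probabilities down to stage
  \<open>\<tau>\<close>. There the outcomes differ by the probability \<open>\<beta>\<close> of
  meeting \<open>S\<close> and \<open>i\<close>; coordinates of smaller stages are
  uncontrolled.\<close>

lemma exchange:
  assumes "reachable \<tau> S" "tight \<tau> S i A" "tight \<tau> S i B" "\<tau> \<ge> 1"
  obtains z z' \<beta> where "z \<in> face" "z' \<in> face" "\<beta> > 0"
    "\<forall>\<sigma>\<in>{\<tau>..n}. \<forall>k j. (z - z' - \<beta> *\<^sub>R (unit i \<tau> A - unit i \<tau> B)) $ (k, j, Abs_stage \<sigma>) = 0"
proof -
  obtain \<pi> where \<pi>: "\<tau> \<le> n" "tight_policy \<pi>" "state_prob \<pi> \<tau> S > 0"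
    using reachable_policy[OF assms(1)] by auto
  define \<beta> where "\<beta> = state_prob \<pi> \<tau> S / real n"
  let ?\<pi> = "override \<pi> \<tau> S i"
  have tight: "tight_policy (?\<pi> A)" "tight_policy (?\<pi> B)"
    using \<pi> assms by (auto intro: tight_override)
  have coord: "outcome (?\<pi> A) $ (k, j, Abs_stage \<sigma>) - outcome (?\<pi> B) $ (k, j, Abs_stage \<sigma>)
      = \<beta> * (unit i \<tau> A - unit i \<tau> B) $ (k, j, Abs_stage \<sigma>)" if "\<sigma> \<in> {\<tau>..n}" for \<sigma> k j
  proof -
    have \<sigma>: "\<sigma> \<in> {1..n}" using that assms(4) by auto
    have u: "unit i \<tau> C $ (k, j, Abs_stage \<sigma>) = of_bool (k = i \<and> \<sigma> = \<tau> \<and> C = Some j)" for C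
    proof -
      have "(Abs_stage \<sigma> :: 'i stage) = Abs_stage \<tau> \<longleftrightarrow> \<sigma> = \<tau>"
        using \<sigma> \<pi>(1) assms(4) by (intro Abs_stage_inject) (auto simp: card_i)
      then show ?thesis
        by (cases C) (auto simp: unit_def axis_def)
    qed
    have "outcome (?\<pi> A) $ (k, j, Abs_stage \<sigma>) - outcome (?\<pi> B) $ (k, j, Abs_stage \<sigma>)
      = (\<Sum>S'\<in>UNIV. state_prob \<pi> \<sigma> S' / real n *
          (of_bool (?\<pi> A \<sigma> S' k = Some j) - of_bool (?\<pi> B \<sigma> S' k = Some j)))"
      using that by (simp add: outcome_eq_state_prob[OF tight(1) \<sigma>] outcome_eq_state_prob[OF tight(2) \<sigma>]
          state_prob_override right_diff_distrib flip: sum_subtractf)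
    also have "\<dots> = (\<Sum>S'\<in>UNIV. if S' = S then \<beta> * (unit i \<tau> A - unit i \<tau> B) $ (k, j, Abs_stage \<sigma>) else 0)"
      by (intro sum.cong refl) (auto simp: override_def \<beta>_def u)
    finally show ?thesis by simp
  qed
  show thesis
  proof (rule that[of "outcome (?\<pi> A)" "outcome (?\<pi> B)" \<beta>])
    show "\<beta> > 0" using \<pi> n_ge_2 by (simp add: \<beta>_def)
  qed (use tight coord in \<open>simp_all add: face_def outcome_achievable lhs_outcome\<close>)
qed

text \<open>Induction upwards from stage 1: the axes of smaller stages absorb the uncontrolled part
  of each exchange. The added axis handles the matches of \<open>s t\<close> into \<open>J\<close>
  at stage \<open>t\<close>, which no tight discard can replace.\<close>

lemma face_directions_span:
  assumes j0: "j0 \<in> J" and z0: "z0 \<in> face"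
  shows "span (insert (axis (s t, j0, Abs_stage t) 1) ((\<lambda>z. z - z0) ` face)) = UNIV"
    (is "span (insert ?e ?D) = UNIV")
proof -
  let ?T = "span (insert ?e ?D)"
  have diff: "z - z' \<in> ?T" if "z \<in> face" "z' \<in> face" for z z'
  proof -
    have "(z - z0) - (z' - z0) \<in> ?T"
      using that by (intro span_diff span_base) auto
    then show ?thesis by simp
  qed
  have axis_in: "axis (i, j, Abs_stage \<tau>) 1 \<in> ?T" if "\<tau> \<in> {1..n}" for i j \<tau>
    using that
  proof (induction \<tau> arbitrary: i j rule: less_induct)
    case (less \<tau>)
    have exch: "unit i \<tau> A - unit i \<tau> B \<in> ?T"
      if r: "reachable \<tau> S" "tight \<tau> S i A" "tight \<tau> S i B" for S A B
    proof -
      have "\<tau> \<ge> 1" using less.prems by simp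
      obtain z z' \<beta> where z: "z \<in> face" "z' \<in> face" "\<beta> > 0" and eq:
        "\<forall>\<sigma>\<in>{\<tau>..n}. \<forall>k j. (z - z' - \<beta> *\<^sub>R (unit i \<tau> A - unit i \<tau> B)) $ (k, j, Abs_stage \<sigma>) = 0"
        by (rule exchange[OF r \<open>\<tau> \<ge> 1\<close>])
      \<comment> \<open>The uncontrolled part, supported on stages below
        \<open>\<tau>\<close>.\<close>
      define w where "w = z - z' - \<beta> *\<^sub>R (unit i \<tau> A - unit i \<tau> B)"
      have "w $ p *\<^sub>R axis p 1 \<in> ?T" for p
      proof -
        obtain k j \<sigma> where p: "p = (k, j, Abs_stage \<sigma>)" "\<sigma> \<in> {1..n}"
          using Abs_stage_cases card_i by (metis prod_cases3)
        show ?thesis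
        proof (cases "\<sigma> < \<tau>")
          case True
          then show ?thesis using less.IH[of \<sigma> k j] p by (simp add: span_scale)
        next
          case False
          then show ?thesis using eq p by (simp add: w_def span_zero)
        qed
      qed
      then have "(\<Sum>p\<in>UNIV. w $ p *\<^sub>R axis p 1) \<in> ?T"
        by (intro span_sum)
      then have "w \<in> ?T" by (simp add: vec_eq_sum_axis)
      then have "(1 / \<beta>) *\<^sub>R ((z - z') - w) \<in> ?T"
        using z by (intro span_scale span_diff[OF diff])
      then show ?thesis
        using z by (simp add: w_def)
    qed
    have match: "axis (i, j, Abs_stage \<tau>) 1 \<in> ?T"
      if "reachable \<tau> S" "\<not> forced \<tau> S i" "tight \<tau> S i (Some j)" for S
      using exch[OF that(1,3), of None] that(2) by (simp add: tight_None unit_def)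
    have UNIV: "reachable \<tau> UNIV"
      using less.prems by (intro reachable_UNIV) simp
    consider "\<tau> < t" | "t \<le> \<tau>" "\<tau> < t + h" "i = s \<tau>" | "t \<le> \<tau>" "\<tau> < t + h" "i \<noteq> s \<tau>" | "t + h \<le> \<tau>"
      by linarith
    then show ?case
    proof cases
      case 1
      then show ?thesis
        by (intro match[OF UNIV] tight_before) (auto simp: forced_def)
    next
      case 2
      show ?thesis
      proof (cases "j \<in> J \<and> \<tau> = t")
        \<comment> \<open>Here \<open>i\<close> is forced, so only differences between two ads of
          \<open>J\<close> arise; the added axis turns them into single axes.\<close>
        case True
        then have "tight \<tau> UNIV i (Some j')" if "j' \<in> J" for j'
          using that 2 h_pos by (intro tight_window) (simp_all add: card_J)
        then have "tight \<tau> UNIV i (Some j)" "tight \<tau> UNIV i (Some j0)"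
          using True j0 by auto
        then have "unit i \<tau> (Some j) - unit i \<tau> (Some j0) \<in> ?T"
          by (rule exch[OF UNIV])
        moreover have "unit i \<tau> (Some j0) \<in> ?T"
          using True 2 by (simp add: unit_def span_base)
        ultimately have "unit i \<tau> (Some j) \<in> ?T"
          using span_add by fastforce
        then show ?thesis by (simp add: unit_def)
      next
        case False
        \<comment> \<open>\<open>K\<close> is to be the rest of \<open>J\<close> in an indifferent
          state in which \<open>j\<close> is still available. For \<open>\<tau> = t\<close> it is
          empty, and then \<open>j\<close> lies outside \<open>J\<close>.\<close>
        have "\<exists>K\<subseteq>J. card K = \<tau> - t \<and> (j \<in> J \<longrightarrow> j \<in> K)"
        proof (cases "j \<in> J")
          case True
          then have "\<exists>K. {j} \<subseteq> K \<and> K \<subseteq> J \<and> card K = \<tau> - t"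
            using False 2 card_J by (intro exists_subset_between) auto
          then show ?thesis by auto
        next
          case False
          have "\<tau> - t \<le> card J" using 2 card_J by auto
          then show ?thesis using False by (meson obtain_subset_with_card_n)
        qed
        then obtain K where K: "K \<subseteq> J" "card K = \<tau> - t" "j \<in> J \<Longrightarrow> j \<in> K" by auto
        let ?S = "- (J - K)"
        have "reachable (t + (\<tau> - t)) ?S"
          using 2 K by (intro reachable_indifferent) auto
        then have r: "reachable \<tau> ?S" using 2 by simp
        have "?S \<inter> J = K" using K by auto
        then have c: "card (?S \<inter> J) = \<tau> - t" using K by simp
        have nf: "\<not> forced \<tau> ?S i" by (simp only: forced_def c) simp
        have jS: "j \<in> ?S" using K by auto
        have "tight \<tau> ?S i (Some j)"
        proof (cases "j \<in> J")
          case True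
          then show ?thesis using 2 jS c by (simp only: \<open>i = s \<tau>\<close>) (rule tight_indifferent)
        next
          case False
          then show ?thesis using tight_outside[OF jS] nf by blast
        qed
        then show ?thesis by (rule match[OF r nf])
      qed
    next
      case 3
      \<comment> \<open>The full set holds \<open>h > \<tau> - t\<close> ads of \<open>J\<close>, so
        both matching and discarding this unrewarded type are tight.\<close>
      then have nf: "\<not> forced \<tau> UNIV i" by (simp add: forced_def)
      moreover have "tight \<tau> UNIV i (Some j)"
        using 3 nf by (cases "j \<in> J") (auto intro!: tight_window simp: tight_outside card_J)
      ultimately show ?thesis by (rule match[OF UNIV])
    next
      case 4
      \<comment> \<open>With \<open>J\<close> intact, a match into \<open>J\<close> gains exactly
        what it costs.\<close>
      then have nf: "\<not> forced \<tau> UNIV i" by (simp add: forced_def)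
      moreover have "tight \<tau> UNIV i (Some j)"
        using 4 nf by (cases "j \<in> J") (auto intro!: tight_early simp: tight_outside)
      ultimately show ?thesis by (rule match[OF UNIV])
    qed
  qed
  have "v \<in> ?T" for v
  proof -
    have "v $ p *\<^sub>R axis p 1 \<in> ?T" for p
    proof -
      obtain k j \<sigma> where "p = (k, j, Abs_stage \<sigma>)" "\<sigma> \<in> {1..n}"
        using Abs_stage_cases card_i by (metis prod_cases3)
      then show ?thesis using axis_in by (simp add: span_scale)
    qed
    then have "(\<Sum>p\<in>UNIV. v $ p *\<^sub>R axis p 1) \<in> ?T"
      by (intro span_sum)
    then show ?thesis by (simp add: vec_eq_sum_axis)
  qed
  then show ?thesis by auto
qed

lemma linear_lhs: "linear lhs"
  by (rule linearI)
    (simp_all add: lhs_eq sum.distrib sum_distrib_left algebra_simps)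

text \<open>\<open>lhs\<close> vanishes on the directions of the face but not on the added axis. The
  axis is thus independent of them, and together they span the space.\<close>

lemma aff_dim_face: "aff_dim face = int DIM(('i, 'v) prob_vec) - 1"
proof -
  have z0: "outcome greedy \<in> face"
    using tight_greedy by (simp add: face_def outcome_achievable lhs_outcome)
  obtain j0 where j0: "j0 \<in> J"
    using card_J h_pos by fastforce
  let ?z = "outcome greedy" and ?e = "axis (s t, j0, Abs_stage t) 1 :: ('i, 'v) prob_vec"
  let ?D = "(\<lambda>z. z - ?z) ` face"
  have "lhs v = 0" if "v \<in> span ?D" for v
  proof (rule linear_eq_0_on_span[OF linear_lhs _ that])
    show "lhs x = 0" if "x \<in> ?D" for x
      using that z0 by (auto simp: linear_diff[OF linear_lhs] face_def)
  qed
  moreover have "lhs ?e \<noteq> 0"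
  proof -
    have t: "t \<in> {1..n}" using t_pos th_le by auto
    \<comment> \<open>The value of the only surviving coefficient is \<open>n ^ h\<close>.\<close>
    have "lhs ?e = (\<Sum>\<tau>=1..n. if \<tau> = t then coef t (s t) j0 else 0)"
      unfolding lhs_eq
    proof (intro sum.cong refl)
      fix \<tau> assume "\<tau> \<in> {1..n}"
      then have "(Abs_stage \<tau> :: 'i stage) = Abs_stage t \<longleftrightarrow> \<tau> = t"
        using t by (intro Abs_stage_inject) (auto simp: card_i)
      then have "coef \<tau> k j * ?e $ (k, j, Abs_stage \<tau>)
          = (if k = s t then if j = j0 then if \<tau> = t then coef \<tau> k j else 0 else 0 else 0)" for k j
        by (simp add: axis_def)
      then show "(\<Sum>k\<in>UNIV. \<Sum>j\<in>UNIV. coef \<tau> k j * ?e $ (k, j, Abs_stage \<tau>))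
        = (if \<tau> = t then coef t (s t) j0 else 0)"
        by (simp add: if_distrib[where f = "sum _"] sum.If_cases)
    qed
    then show ?thesis
      using t j0 n_ge_2 h_pos by (simp add: coef_def)
  qed
  ultimately have "?e \<notin> span ?D" by blast
  then have "dim (insert ?e ?D) = dim ?D + 1"
    by (simp add: dim_insert)
  moreover have "dim (insert ?e ?D) = DIM(('i, 'v) prob_vec)"
    using face_directions_span[OF j0 z0] by (metis dim_UNIV dim_span)
  moreover have "aff_dim face = int (dim ((+) (- ?z) ` face))"
    using z0 by (intro aff_dim_eq_dim hull_inc)
  moreover have "(+) (- ?z) ` face = ?D"
    by (intro image_cong) auto
  ultimately show ?thesis by simp
qed

end

theorem theorem5:
  fixes n h t :: nat
    and J :: "'v::finite set"
    and i :: "nat \<Rightarrow> 'i::finite"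
  assumes "CARD('i) = n" and "CARD('v) = n"
    and "card J = h" and "h \<in> {1..n-1}"
    and "t \<in> {1..n-h}"
  shows "facet_defining (achievable :: ('i, 'v) prob_vec set)
    (\<lambda>z. (\<Sum>\<tau>=t+h..n. Z UNIV J \<tau> z)
        + (\<Sum>\<tau>=t..t+h-1. real n ^ (t + h - \<tau>) * Z {i \<tau>} J \<tau> z))
    (1 + (\<Sum>\<tau>=1..h-1. real n ^ \<tau>))"
proof -
  interpret matching_face n h t J i
    using assms by unfold_locales
  show ?thesis
    using lhs_le aff_dim_face
    unfolding facet_defining_def lhs_def[symmetric] rhs_def[symmetric] face_def by simp
qed

end
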